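(* Let $n,N\ge1$, let $M\in\mathrm{rep}_{\mathbb C}(\Delta_n,\mathrm I_N)$ have $d$ indecomposable direct summands, let $\mathbf e\in\mathbb Z_{\ge0}^{\mathbb Z_n}$, and let $T=(\mathbb C^* )^{d+1}$ act on $\mathrm{Gr}_{\mathbf e}(M)$ and on the quiver Grassmannians of $\hat M$ as described in the context. Then the desingularization $$\pi=\bigsqcup_{[E]\in\mathrm{gsub}_{\mathbf e}(M)}\pi_E:\ \bigsqcup_{[E]\in\mathrm{gsub}_{\mathbf e}(M)}\mathrm{Gr}_{\mathbf{dim}\,\hat E}(\hat M)\to\mathrm{Gr}_{\mathbf e}(M)$$ is $T$-equivariant.
   Context: All representations are finite dimensional over $\mathbb C$; $[m]:=\{1,\dots,m\}$; $\mathbb Z_n:=\mathbb Z/n\mathbb Z$. Cycle quiver: $\Delta_n$ has vertex set $\mathbb Z_n$ and one arrow $i\to i+1$ for each $i\in\mathbb Z_n$. A representation $M$ consists of vector spaces $M^{(i)}$ and linear maps $M_i:M^{(i)}\to M^{(i+1)}$. $\mathrm{rep}_{\mathbb C}(\Delta_n,\mathrm I_N)$ is the category of representations of $\Delta_n$ in which every composition of $N$ consecutive maps vanishes. Cylinder quiver: $\hat\Delta_{n,N}$ has vertices $(i,k)$, $i\in\mathbb Z_n$, $k\in[N]$, and arrows $\alpha_{i,k}:(i,k)\to(i,k+1)$ for $k\in[N-1]$ and $\beta_{i,k}:(i,k)\to(i+1,k-1)$ for $k\in[N]\setminus\{1\}$. Functor $\Lambda$: for $M\in\mathrm{rep}_{\mathbb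 C}(\Delta_n,\mathrm I_N)$ let $\hat M=\Lambda(M)$ be the representation of $\hat\Delta_{n,N}$ with $\hat M^{(i,1)}=M^{(i)}$, $\hat M^{(i,k)}=M_{i+k-2}\circ\cdots\circ M_i(M^{(i)})\subseteq M^{(i+k-1)}$ for $k\ge2$; $\hat M_{\alpha_{i,k}}$ is the restriction of $M_{i+k-1}$, and $\hat M_{\beta_{i,k}}:\hat M^{(i,k)}\hookrightarrow\hat M^{(i+1,k-1)}$ is the natural inclusion of subspaces of $M^{(i+k-1)}$. Quiver Grassmannians: for a representation $V$ of a quiver and a dimension vector $\mathbf f$, $\mathrm{Gr}_{\mathbf f}(V)$ is the closed subvariety of $\prod_v\mathrm{Gr}_{f_v}(V^{(v)})$ consisting of all subrepresentations of $V$ of dimension vector $\mathbf f$. $\mathbf{dim}\,V$ is the dimension vector of $V$. $\mathcal S_{[E]}\subseteq\mathrm{Gr}_{\mathbf e}(M)$ is the set of all $U\in\mathrm{Gr}_{\mathbf e}(M)$ with $U\cong E$. $\mathrm{gsub}_{\mathbf e}(M)$ is the set of isomorphism classes $[E]$ such that $\mathcal S_{[E]}$ is (nonempty and) open in $\mathrm{Gr}_{\mathbf e}(M)$. The map $\pi_E:\mathrm{Gr}_{\mathbf{dim}\,\hat E}(\hat M)\to\mathrm{Gr}_{\mathbf e}(M)$ sends $U$ to its restriction $\mathrm{res}\,U=(U^{(i,1)})_{i\in\mathbb Z_n}$, with maps $U_{\beta_{i,2}}\circ U_{\alpha_{i,1}}$ (zero for $N=1$). Torus action: write $M$ as a direct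 sum of $d$ indecomposables and choose a basis $B=\{b_{j,s}: j\in[d],\,s\in[\ell_j]\}$ of $M$, with each $b_{j,s}$ lying in some $M^{(i)}$, such that for each $j$ the $b_{j,1},\dots,b_{j,\ell_j}$ form a basis of the $j$-th summand and the structure maps of $M$ send $b_{j,s}\mapsto b_{j,s+1}$ for $s<\ell_j$ and $b_{j,\ell_j}\mapsto0$. Then $\gamma=(\gamma_0,\gamma_1,\dots,\gamma_d)\in T=(\mathbb C^* )^{d+1}$ acts linearly on the spaces $M^{(i)}$ by $\gamma.b_{j,s}=\gamma_0^{s-1}\gamma_j\,b_{j,s}$, which induces the action on $\mathrm{Gr}_{\mathbf e}(M)$. Each $\hat M^{(i,k)}\subseteq M^{(i+k-1)}$ is spanned by a subset of the basis vectors $b_{j,s}$ lying in $M^{(i+k-1)}$, and $T$ acts on $\hat M^{(i,k)}$ by the same weights; this induces the action on every quiver Grassmannian of $\hat M$. *)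

theory Defs
  imports
    "HOL-Analysis.Abstract_Topology"
    "HOL-Algebra.Group_Action"
    "HOL-Algebra.Product_Groups"
    "Graph_Theory.Digraph"
    "Jordan_Normal_Form.Determinant"
begin

section \<open>Complex vector spaces\<close>

class complex_vector = ab_group_add +
  fixes scaleC :: "complex \<Rightarrow> 'a \<Rightarrow> 'a"
  assumes scaleC_add_right: "scaleC a (x + y) = scaleC a x + scaleC a y"
    and scaleC_add_left: "scaleC (a + b) x = scaleC a x + scaleC b x"
    and scaleC_scaleC: "scaleC a (scaleC b x) = scaleC (a * b) x"
    and scaleC_one: "scaleC 1 x = x"

instantiation complex :: complex_vector
begin

definition "scaleC (a :: complex) (x :: complex) = a * x"

instance
  by standard (simp_all add: scaleC_complex_def algebra_simps)

end

global_interpretation cv: vector_space "scaleC :: complex \<Rightarrow> 'x \<Rightarrow> 'x::complex_vector"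
  by unfold_locales (simp_all add: scaleC_add_right scaleC_add_left scaleC_scaleC scaleC_one)

definition fd_subspace :: "'x::complex_vector set \<Rightarrow> bool" where
  "fd_subspace V \<longleftrightarrow> (\<exists>B. finite B \<and> V = cv.span B)"

definition linear_between :: "'x::complex_vector set \<Rightarrow> 'x set \<Rightarrow> ('x \<Rightarrow> 'x) \<Rightarrow> bool" where
  "linear_between V W f \<longleftrightarrow>
     f ` V \<subseteq> W \<and>
     (\<forall>x\<in>V. \<forall>y\<in>V. f (x + y) = f x + f y) \<and>
     (\<forall>c. \<forall>x\<in>V. f (scaleC c x) = scaleC c (f x))"


section \<open>Representations of quivers\<close>

text \<open>
  A quiver is a directed multigraph.  All the vector spaces of a representation are
  subspaces of one ambient complex vector space \<open>'x\<close>, of arbitrary dimension; the spaces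
  at different vertices need not be independent (they may even coincide), so a family of
  vectors indexed by vertices is never identified with its sum in \<open>'x\<close>.  The map at an arrow
  is only meaningful on the space at the tail of the arrow.
\<close>

record ('v, 'a, 'x) qrep =
  vsp :: "'v \<Rightarrow> 'x set"
  vmap :: "'a \<Rightarrow> 'x \<Rightarrow> 'x"

definition is_rep :: "('v, 'a) pre_digraph \<Rightarrow> ('v, 'a, 'x::complex_vector) qrep \<Rightarrow> bool" where
  "is_rep Q V \<longleftrightarrow>
     (\<forall>v\<in>verts Q. fd_subspace (vsp V v)) \<and>
     (\<forall>a\<in>arcs Q. linear_between (vsp V (tail Q a)) (vsp V (head Q a)) (vmap V a))"

definition rep_iso ::
  "('v, 'a) pre_digraph \<Rightarrow> ('v, 'a, 'x::complex_vector) qrep \<Rightarrow> ('v, 'a, 'x) qrep \<Rightarrow> bool" where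
  "rep_iso Q V W \<longleftrightarrow>
     (\<exists>\<phi>. (\<forall>v\<in>verts Q. linear_between (vsp V v) (vsp W v) (\<phi> v) \<and>
                       bij_betw (\<phi> v) (vsp V v) (vsp W v)) \<and>
          (\<forall>a\<in>arcs Q. \<forall>x\<in>vsp V (tail Q a).
             \<phi> (head Q a) (vmap V a x) = vmap W a (\<phi> (tail Q a) x)))"

definition iso_class ::
  "('v, 'a) pre_digraph \<Rightarrow> ('v, 'a, 'x::complex_vector) qrep \<Rightarrow> ('v, 'a, 'x) qrep set" where
  "iso_class Q E = {E'. is_rep Q E' \<and> rep_iso Q E E'}"

definition dimvec :: "('v, 'a, 'x::complex_vector) qrep \<Rightarrow> 'v \<Rightarrow> nat" where
  "dimvec V v = cv.dim (vsp V v)"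

definition is_subrep ::
  "('v, 'a) pre_digraph \<Rightarrow> ('v, 'a, 'x::complex_vector) qrep \<Rightarrow> ('v \<Rightarrow> 'x set) \<Rightarrow> bool" where
  "is_subrep Q V U \<longleftrightarrow>
     (\<forall>v\<in>verts Q. cv.subspace (U v) \<and> U v \<subseteq> vsp V v) \<and>
     (\<forall>a\<in>arcs Q. vmap V a ` U (tail Q a) \<subseteq> U (head Q a))"

definition subrep ::
  "('v, 'a, 'x::complex_vector) qrep \<Rightarrow> ('v \<Rightarrow> 'x set) \<Rightarrow> ('v, 'a, 'x) qrep" where
  "subrep V U = \<lparr>vsp = U, vmap = vmap V\<rparr>"

definition is_direct_sum ::
  "('v, 'a) pre_digraph \<Rightarrow> ('v, 'a, 'x::complex_vector) qrep \<Rightarrow> nat set \<Rightarrow>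
    (nat \<Rightarrow> 'v \<Rightarrow> 'x set) \<Rightarrow> bool" where
  "is_direct_sum Q V I S \<longleftrightarrow>
     (\<forall>j\<in>I. is_subrep Q V (S j)) \<and>
     (\<forall>v\<in>verts Q.
        vsp V v = {(\<Sum>j\<in>I. x j) |x. \<forall>j\<in>I. x j \<in> S j v} \<and>
        (\<forall>x. (\<forall>j\<in>I. x j \<in> S j v) \<and> (\<Sum>j\<in>I. x j) = 0 \<longrightarrow> (\<forall>j\<in>I. x j = 0)))"

definition zero_rep ::
  "('v, 'a) pre_digraph \<Rightarrow> ('v, 'a, 'x::complex_vector) qrep \<Rightarrow> bool" where
  "zero_rep Q V \<longleftrightarrow> (\<forall>v\<in>verts Q. vsp V v = {0})"

definition indecomposable ::
  "('v, 'a) pre_digraph \<Rightarrow> ('v, 'a, 'x::complex_vector) qrep \<Rightarrow> bool" where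
  "indecomposable Q V \<longleftrightarrow>
     \<not> zero_rep Q V \<and>
     (\<forall>S. is_direct_sum Q V {1, 2} S \<longrightarrow>
        zero_rep Q (subrep V (S 1)) \<or> zero_rep Q (subrep V (S 2)))"

definition indecomposable_decomposition ::
  "('v, 'a) pre_digraph \<Rightarrow> ('v, 'a, 'x::complex_vector) qrep \<Rightarrow> nat \<Rightarrow>
    (nat \<Rightarrow> 'v \<Rightarrow> 'x set) \<Rightarrow> bool" where
  "indecomposable_decomposition Q V d S \<longleftrightarrow>
     is_direct_sum Q V {1..d} S \<and> (\<forall>j\<in>{1..d}. indecomposable Q (subrep V (S j)))"


section \<open>Quiver Grassmannians and their Zariski topology\<close>

text \<open>
  A point is the family of its subspaces (extensional, i.e. \<open>undefined\<close> off the
  vertices); its maps are the restrictions of those of \<open>V\<close>, see \<open>subrep\<close>.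
\<close>

definition Gr ::
  "('v, 'a) pre_digraph \<Rightarrow> ('v, 'a, 'x::complex_vector) qrep \<Rightarrow> ('v \<Rightarrow> nat) \<Rightarrow> ('v \<Rightarrow> 'x set) set"
  where
  "Gr Q V f =
     {U \<in> extensional (verts Q). is_subrep Q V U \<and> (\<forall>v\<in>verts Q. cv.dim (U v) = f v)}"

definition frames ::
  "'v set \<Rightarrow> ('v \<Rightarrow> nat) \<Rightarrow> ('v \<Rightarrow> 'x::complex_vector set) \<Rightarrow> ('v \<Rightarrow> nat \<Rightarrow> 'x) set" where
  "frames Vs f U =
     {u. \<forall>v\<in>Vs. inj_on (u v) {..<f v} \<and> cv.independent (u v ` {..<f v}) \<and>
                cv.span (u v ` {..<f v}) = U v}"

text \<open>
  \<open>plucker_form Vs f D p\<close>: \<open>p\<close> is a polynomial in the Pluecker coordinates of the factors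
  \<open>Gr(f v, V v)\<close>, multihomogeneous of degree \<open>D v\<close> in those at the vertex \<open>v\<close>.  It is
  represented as a function of a family \<open>u\<close> of bases.  The Pluecker coordinates at \<open>v\<close> are the
  minors \<open>det (\<phi>\<^sub>a (u v b))\<close> for linear functionals \<open>\<phi>\<^sub>a\<close>; taking all functionals instead of
  those of a fixed dual basis only adds linear combinations of the coordinates.
\<close>

inductive plucker_form ::
  "'v set \<Rightarrow> ('v \<Rightarrow> nat) \<Rightarrow> ('v \<Rightarrow> nat) \<Rightarrow> (('v \<Rightarrow> nat \<Rightarrow> 'x::complex_vector) \<Rightarrow> complex) \<Rightarrow> bool"
  for Vs f where
  const: "plucker_form Vs f (\<lambda>v. 0) (\<lambda>u. c)"
| coordinate: "\<lbrakk>v \<in> Vs; \<And>a. Vector_Spaces.linear scaleC (*) (\<phi> a)\<rbrakk> \<Longrightarrow>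
    plucker_form Vs f (\<lambda>w. if w = v then 1 else 0)
      (\<lambda>u. det (mat (f v) (f v) (\<lambda>(a, b). \<phi> a (u v b))))"
| add: "\<lbrakk>plucker_form Vs f D p; plucker_form Vs f D q\<rbrakk> \<Longrightarrow>
    plucker_form Vs f D (\<lambda>u. p u + q u)"
| mult: "\<lbrakk>plucker_form Vs f D p; plucker_form Vs f D' q\<rbrakk> \<Longrightarrow>
    plucker_form Vs f (\<lambda>v. D v + D' v) (\<lambda>u. p u * q u)"

text \<open>
  The topology induced by the multi-projective Pluecker embedding of the product of the
  Grassmannians.  By multihomogeneity, whether \<open>p u\<close> vanishes does not depend on the frame
  \<open>u\<close> of \<open>U\<close>.
\<close>

definition zariski ::
  "('v, 'a) pre_digraph \<Rightarrow> ('v, 'a, 'x::complex_vector) qrep \<Rightarrow> ('v \<Rightarrow> nat) \<Rightarrow> ('v \<Rightarrow> 'x set) topology"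
  where
  "zariski Q V f =
     topology_generated_by
       {{U \<in> Gr Q V f. \<forall>u\<in>frames (verts Q) f U. p u \<noteq> 0} |D p. plucker_form (verts Q) f D p}"

definition stratum ::
  "('v, 'a) pre_digraph \<Rightarrow> ('v, 'a, 'x::complex_vector) qrep \<Rightarrow> ('v \<Rightarrow> nat) \<Rightarrow>
    ('v, 'a, 'x) qrep \<Rightarrow> ('v \<Rightarrow> 'x set) set" where
  "stratum Q V f E = {U \<in> Gr Q V f. rep_iso Q (subrep V U) E}"

text \<open>
  Isomorphism classes are taken among representations on subspaces of the ambient space \<open>'x\<close>;
  no class with nonempty stratum is lost, since a subrepresentation of \<open>V\<close> is of this kind.
\<close>

definition gsub ::
  "('v, 'a) pre_digraph \<Rightarrow> ('v, 'a, 'x::complex_vector) qrep \<Rightarrow> ('v \<Rightarrow> nat) \<Rightarrow>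
    ('v, 'a, 'x) qrep set set" where
  "gsub Q V f =
     {iso_class Q E |E. is_rep Q E \<and> stratum Q V f E \<noteq> {} \<and>
                        openin (zariski Q V f) (stratum Q V f E)}"


section \<open>The cycle and cylinder quivers\<close>

text \<open>The vertex set \<open>\<int>/n\<int>\<close> is \<open>{..<n}\<close>; the arrow out of \<open>i\<close> is also called \<open>i\<close>.\<close>

definition cycle_quiver :: "nat \<Rightarrow> (nat, nat) pre_digraph" where
  "cycle_quiver n =
     \<lparr>verts = {..<n}, arcs = {..<n}, tail = (\<lambda>i. i), head = (\<lambda>i. (i + 1) mod n)\<rparr>"

text \<open>\<open>path_map n M i m\<close> is the composition of \<open>m\<close> consecutive maps starting at the vertex \<open>i\<close>.\<close>

primrec path_map :: "nat \<Rightarrow> (nat, nat, 'x) qrep \<Rightarrow> nat \<Rightarrow> nat \<Rightarrow> 'x \<Rightarrow> 'x" where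
  "path_map n M i 0 = id"
| "path_map n M i (Suc m) = vmap M ((i + m) mod n) \<circ> path_map n M i m"

definition nilpotent_rep :: "nat \<Rightarrow> nat \<Rightarrow> (nat, nat, 'x::complex_vector) qrep \<Rightarrow> bool" where
  "nilpotent_rep n N M \<longleftrightarrow>
     is_rep (cycle_quiver n) M \<and> (\<forall>i<n. \<forall>x\<in>vsp M i. path_map n M i N x = 0)"

datatype cyl_arrow = Alpha nat nat | Beta nat nat

definition cyl_quiver :: "nat \<Rightarrow> nat \<Rightarrow> (nat \<times> nat, cyl_arrow) pre_digraph" where
  "cyl_quiver n N =
     \<lparr>verts = {..<n} \<times> {1..N},
      arcs = {Alpha i k |i k. i < n \<and> k \<in> {1..<N}} \<union> {Beta i k |i k. i < n \<and> k \<in> {2..N}},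
      tail = (\<lambda>a. case a of Alpha i k \<Rightarrow> (i, k) | Beta i k \<Rightarrow> (i, k)),
      head = (\<lambda>a. case a of Alpha i k \<Rightarrow> (i, k + 1) | Beta i k \<Rightarrow> ((i + 1) mod n, k - 1))\<rparr>"

definition Lam ::
  "nat \<Rightarrow> (nat, nat, 'x::complex_vector) qrep \<Rightarrow> (nat \<times> nat, cyl_arrow, 'x) qrep" where
  "Lam n M =
     \<lparr>vsp = (\<lambda>(i, k). path_map n M i (k - 1) ` vsp M i),
      vmap = (\<lambda>a. case a of Alpha i k \<Rightarrow> vmap M ((i + k - 1) mod n) | Beta i k \<Rightarrow> id)\<rparr>"

definition res_rep ::
  "nat \<Rightarrow> (nat \<times> nat, cyl_arrow, 'x::complex_vector) qrep \<Rightarrow> (nat, nat, 'x) qrep" where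
  "res_rep N W =
     \<lparr>vsp = (\<lambda>i. vsp W (i, 1)),
      vmap = (\<lambda>i. if N = 1 then (\<lambda>x. 0) else vmap W (Beta i 2) \<circ> vmap W (Alpha i 1))\<rparr>"


section \<open>The desingularization\<close>

text \<open>
  \<open>dim_hat n c\<close> is the dimension vector of \<open>\<Lambda>(E)\<close> for \<open>[E] = c\<close>; isomorphic
  representations have isomorphic images under \<open>\<Lambda>\<close>, so the choice of \<open>E\<close> is immaterial.
\<close>

definition dim_hat ::
  "nat \<Rightarrow> (nat, nat, 'x::complex_vector) qrep set \<Rightarrow> nat \<times> nat \<Rightarrow> nat" where
  "dim_hat n c = dimvec (Lam n (SOME E. E \<in> c))"

definition desing_source ::
  "nat \<Rightarrow> nat \<Rightarrow> (nat, nat, 'x::complex_vector) qrep \<Rightarrow> (nat \<Rightarrow> nat) \<Rightarrow>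
    ((nat, nat, 'x) qrep set \<times> (nat \<times> nat \<Rightarrow> 'x set)) set" where
  "desing_source n N M e =
     (SIGMA c : gsub (cycle_quiver n) M e. Gr (cyl_quiver n N) (Lam n M) (dim_hat n c))"

text \<open>The formula for \<open>\<pi>\<^sub>E\<close> is the same for all \<open>E\<close>; only its domain depends on \<open>E\<close>.\<close>

definition pi_map ::
  "nat \<Rightarrow> nat \<Rightarrow> (nat, nat, 'x::complex_vector) qrep \<Rightarrow>
    (nat \<times> nat \<Rightarrow> 'x set) \<Rightarrow> (nat \<Rightarrow> 'x set)" where
  "pi_map n N M U = restrict (vsp (res_rep N (subrep (Lam n M) U))) (verts (cycle_quiver n))"

definition desing_map ::
  "nat \<Rightarrow> nat \<Rightarrow> (nat, nat, 'x::complex_vector) qrep \<Rightarrow>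
    (nat, nat, 'x) qrep set \<times> (nat \<times> nat \<Rightarrow> 'x set) \<Rightarrow> (nat \<Rightarrow> 'x set)" where
  "desing_map n N M = (\<lambda>(c, U). pi_map n N M U)"


section \<open>The torus action\<close>

definition torus :: "nat \<Rightarrow> (nat \<Rightarrow> complex) monoid" where
  "torus d = product_group {0..d} (\<lambda>_. \<lparr>carrier = - {0}, monoid.mult = (*), one = 1\<rparr>)"

text \<open>
  The basis vector \<open>b j s\<close> (\<open>1 \<le> j \<le> d\<close>, \<open>1 \<le> s \<le> l j\<close>) lies in the space at the vertex
  \<open>vt j s\<close>.  The vertex has to be recorded because the spaces at different vertices may meet.
\<close>

definition basis_at ::
  "(nat \<Rightarrow> nat) \<Rightarrow> (nat \<Rightarrow> nat \<Rightarrow> nat) \<Rightarrow> nat \<Rightarrow> nat \<Rightarrow> nat set" where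
  "basis_at l vt j i = {s \<in> {1..l j}. vt j s = i}"

definition adapted_basis ::
  "nat \<Rightarrow> (nat, nat, 'x::complex_vector) qrep \<Rightarrow> nat \<Rightarrow> (nat \<Rightarrow> nat \<Rightarrow> 'x set) \<Rightarrow>
    (nat \<Rightarrow> nat) \<Rightarrow> (nat \<Rightarrow> nat \<Rightarrow> nat) \<Rightarrow> (nat \<Rightarrow> nat \<Rightarrow> 'x) \<Rightarrow> bool" where
  "adapted_basis n M d S l vt b \<longleftrightarrow>
     (\<forall>j\<in>{1..d}.
        (\<forall>s\<in>{1..l j}. vt j s < n) \<and>
        (\<forall>i<n. inj_on (b j) (basis_at l vt j i) \<and>
               cv.independent (b j ` basis_at l vt j i) \<and>
               cv.span (b j ` basis_at l vt j i) = S j i) \<and>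
        (\<forall>s\<in>{1..<l j}. vt j (s + 1) = (vt j s + 1) mod n \<and>
                       vmap M (vt j s) (b j s) = b j (s + 1)) \<and>
        (1 \<le> l j \<longrightarrow> vmap M (vt j (l j)) (b j (l j)) = 0))"

text \<open>
  The linear operator by which \<open>\<gamma>\<close> acts on the space at the vertex \<open>i\<close>;
  \<open>cv.representation B x v\<close> is the coefficient of \<open>v\<close> in the expansion of \<open>x\<close> in the basis \<open>B\<close>.
\<close>

definition torus_op ::
  "nat \<Rightarrow> (nat \<Rightarrow> nat) \<Rightarrow> (nat \<Rightarrow> nat \<Rightarrow> nat) \<Rightarrow> (nat \<Rightarrow> nat \<Rightarrow> 'x::complex_vector) \<Rightarrow>
    (nat \<Rightarrow> complex) \<Rightarrow> nat \<Rightarrow> 'x \<Rightarrow> 'x" where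
  "torus_op d l vt b \<gamma> i x =
     (let J = (SIGMA j : {1..d}. basis_at l vt j i); B = (\<lambda>(j, s). b j s) ` J
      in \<Sum>(j, s)\<in>J. scaleC (\<gamma> 0 ^ (s - 1) * \<gamma> j * cv.representation B x (b j s)) (b j s))"

definition act_target ::
  "nat \<Rightarrow> (nat, nat, 'x::complex_vector) qrep \<Rightarrow> (nat \<Rightarrow> nat) \<Rightarrow>
    nat \<Rightarrow> (nat \<Rightarrow> nat) \<Rightarrow> (nat \<Rightarrow> nat \<Rightarrow> nat) \<Rightarrow> (nat \<Rightarrow> nat \<Rightarrow> 'x) \<Rightarrow>
    (nat \<Rightarrow> complex) \<Rightarrow> (nat \<Rightarrow> 'x set) \<Rightarrow> (nat \<Rightarrow> 'x set)" where
  "act_target n M e d l vt b \<gamma> =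
     (\<lambda>U \<in> Gr (cycle_quiver n) M e.
        \<lambda>i \<in> verts (cycle_quiver n). torus_op d l vt b \<gamma> i ` U i)"

definition act_source ::
  "nat \<Rightarrow> nat \<Rightarrow> (nat, nat, 'x::complex_vector) qrep \<Rightarrow> (nat \<Rightarrow> nat) \<Rightarrow>
    nat \<Rightarrow> (nat \<Rightarrow> nat) \<Rightarrow> (nat \<Rightarrow> nat \<Rightarrow> nat) \<Rightarrow> (nat \<Rightarrow> nat \<Rightarrow> 'x) \<Rightarrow> (nat \<Rightarrow> complex) \<Rightarrow>
    (nat, nat, 'x) qrep set \<times> (nat \<times> nat \<Rightarrow> 'x set) \<Rightarrow>
    (nat, nat, 'x) qrep set \<times> (nat \<times> nat \<Rightarrow> 'x set)" where
  "act_source n N M e d l vt b \<gamma> =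
     (\<lambda>(c, U) \<in> desing_source n N M e.
        (c, \<lambda>(i, k) \<in> verts (cyl_quiver n N).
              torus_op d l vt b \<gamma> ((i + k - 1) mod n) ` U (i, k)))"

text \<open>
  The operations are required to be actions and the map to be well defined.
\<close>

definition equivariant_map ::
  "('g, 'm) monoid_scheme \<Rightarrow> 'p set \<Rightarrow> ('g \<Rightarrow> 'p \<Rightarrow> 'p) \<Rightarrow> 'q set \<Rightarrow> ('g \<Rightarrow> 'q \<Rightarrow> 'q) \<Rightarrow>
    ('p \<Rightarrow> 'q) \<Rightarrow> bool" where
  "equivariant_map G X \<phi> Y \<psi> f \<longleftrightarrow>
     group_action G X \<phi> \<and> group_action G Y \<psi> \<and> f \<in> X \<rightarrow> Y \<and>
     (\<forall>g\<in>carrier G. \<forall>x\<in>X. f (\<phi> g x) = \<psi> g (f x))"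

end

theory Submission
  imports Defs
begin

text \<open>
  The element \<open>\<gamma>\<close> acts on the spaces of \<open>M\<close> by operators that are diagonal in the adapted
  basis.  A structure map raises the exponent of \<open>\<gamma> 0\<close> by one, so \<open>\<gamma>\<close> commutes with it up to
  the scalar \<open>\<gamma> 0\<close> (\<open>torus_op_vmap\<close>), and with a composition of \<open>m\<close> of them up to
  \<open>\<gamma> 0 ^ m\<close>.  Therefore \<open>\<gamma>\<close> maps the images that constitute \<open>\<Lambda>(M)\<close> to themselves
  (\<open>torus_op_Lam\<close>), and it commutes with the structure maps of \<open>\<Lambda>(M)\<close> up to scalars as well:
  along \<open>\<alpha>\<close> the scalar is that of \<open>M\<close>, along \<open>\<beta>\<close>, an inclusion of subspaces of one space on
  which \<open>\<gamma>\<close> acts by one operator, it is \<open>1\<close>.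

  Since subspaces are stable under scalars, such operators move subrepresentations to
  subrepresentations of the same dimension vector.  This is isolated in the locale
  \<open>semi_invariant_action\<close>, whose \<open>group_action_Gr\<close> yields both the action on the target and, for
  each class in \<open>gsub\<close>, the action on the corresponding part of the source; these parts are put
  together by \<open>group_action_Sigma\<close>.

  The map lands in the target because a structure map of \<open>M\<close> is the composition of an
  \<open>\<alpha>\<close> and a \<open>\<beta>\<close>, or zero if \<open>N = 1\<close>, and because \<open>dim_hat\<close> agrees with \<open>e\<close> on the first layer
  (\<open>pi_map_in_Gr\<close>).  Equivariance itself is then immediate, as \<open>\<pi>\<close> only restricts a family
  of subspaces to the first layer, where the torus acts on both sides by the same operators.
\<close>

section \<open>Linear maps between subspaces\<close>

lemma linear_betweenI:
  assumes "\<And>x. x \<in> V \<Longrightarrow> f x \<in> W"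
    and "\<And>x y. \<lbrakk>x \<in> V; y \<in> V\<rbrakk> \<Longrightarrow> f (x + y) = f x + f y"
    and "\<And>c x. x \<in> V \<Longrightarrow> f (scaleC c x) = scaleC c (f x)"
  shows "linear_between V W f"
  using assms by (auto simp: linear_between_def)

lemma linear_between_mem: "linear_between V W f \<Longrightarrow> x \<in> V \<Longrightarrow> f x \<in> W"
  by (auto simp: linear_between_def)

lemma linear_between_add:
  "linear_between V W f \<Longrightarrow> x \<in> V \<Longrightarrow> y \<in> V \<Longrightarrow> f (x + y) = f x + f y"
  by (auto simp: linear_between_def)

lemma linear_between_scale:
  "linear_between V W f \<Longrightarrow> x \<in> V \<Longrightarrow> f (scaleC c x) = scaleC c (f x)"
  by (auto simp: linear_between_def)

lemma linear_between_id: "linear_between V V (\<lambda>x. x)"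
  by (auto simp: linear_between_def)

lemma linear_between_comp:
  assumes "linear_between U V f" "linear_between V W g"
  shows "linear_between U W (\<lambda>x. g (f x))"
  by (rule linear_betweenI)
     (simp_all add: linear_between_mem[OF assms(1)] linear_between_mem[OF assms(2)]
        linear_between_add[OF assms(1)] linear_between_add[OF assms(2)]
        linear_between_scale[OF assms(1)] linear_between_scale[OF assms(2)])

lemma linear_between_scaled:
  assumes "linear_between V W f" "cv.subspace W"
  shows "linear_between V W (\<lambda>x. scaleC c (f x))"
  by (rule linear_betweenI)
     (simp_all add: linear_between_mem[OF assms(1)] cv.subspace_scale[OF assms(2)]
        linear_between_add[OF assms(1)] linear_between_scale[OF assms(1)]
        scaleC_add_right scaleC_scaleC mult.commute)

lemma linear_between_subset:
  assumes "linear_between V W f" "U \<subseteq> V" "f ` U \<subseteq> W'"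
  shows "linear_between U W' f"
  using assms by (auto simp: linear_between_def subset_iff)

lemma linear_between_eq_on_span:
  assumes f: "linear_between (cv.span B) W f" and g: "linear_between (cv.span B) W g"
    and eq: "\<And>x. x \<in> B \<Longrightarrow> f x = g x" and x: "x \<in> cv.span B"
  shows "f x = g x"
proof -
  have "x \<in> cv.span B \<and> f x = g x"
    using x
  proof (induction rule: cv.span_induct_alt)
    case base
    have "f (scaleC 0 0) = scaleC 0 (f 0)" "g (scaleC 0 0) = scaleC 0 (g 0)"
      using linear_between_scale[OF f cv.span_zero] linear_between_scale[OF g cv.span_zero] by auto
    then show ?case by (simp add: cv.span_zero)
  next
    case (step c x y)
    then show ?case
      by (simp add: linear_between_add[OF f] linear_between_add[OF g] linear_between_scale[OF f]
          linear_between_scale[OF g] cv.span_base cv.span_scale cv.span_add eq)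
  qed
  then show ?thesis by simp
qed

lemma fd_subspace_imp_subspace: "fd_subspace V \<Longrightarrow> cv.subspace V"
  unfolding fd_subspace_def using cv.subspace_span by metis

text \<open>
  Extending to the whole ambient space gives access to the theory of linear operators.
\<close>

lemma linear_between_extension:
  assumes "cv.subspace V" "linear_between V W f"
  obtains g where "Vector_Spaces.linear scaleC scaleC g" "\<forall>x\<in>V. g x = f x"
proof -
  interpret p: vector_space_pair "scaleC :: complex \<Rightarrow> 'a \<Rightarrow> 'a" "scaleC :: complex \<Rightarrow> 'a \<Rightarrow> 'a" ..
  obtain B where B: "B \<subseteq> V" "cv.independent B" "V \<subseteq> cv.span B"
    by (rule cv.basis_exists)
  have V: "cv.span B = V"
    using B assms(1) by (simp add: cv.span_subspace)
  obtain g where g: "Vector_Spaces.linear scaleC scaleC g" "\<forall>x\<in>B. g x = f x"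
    using p.linear_independent_extend[OF B(2)] by blast
  have "linear_between (cv.span B) UNIV g"
    by (rule linear_betweenI) (simp_all add: p.linear_add[OF g(1)] p.linear_scale[OF g(1)])
  moreover have "linear_between (cv.span B) UNIV f"
    using assms(2) by (simp add: V linear_between_def)
  ultimately have "g x = f x" if "x \<in> V" for x
    by (rule linear_between_eq_on_span) (use g(2) that V in simp_all)
  then show ?thesis using that[OF g(1)] by blast
qed

lemma subspace_linear_between_image:
  assumes "cv.subspace V" "linear_between V W f"
  shows "cv.subspace (f ` V)"
proof -
  interpret p: vector_space_pair "scaleC :: complex \<Rightarrow> 'a \<Rightarrow> 'a" "scaleC :: complex \<Rightarrow> 'a \<Rightarrow> 'a" ..
  obtain g where g: "Vector_Spaces.linear scaleC scaleC g" "\<forall>x\<in>V. g x = f x"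
    by (rule linear_between_extension[OF assms])
  have "f ` V = g ` V" using g(2) by auto
  then show ?thesis using p.linear_subspace_image[OF g(1) assms(1)] by simp
qed

lemma dim_linear_bij:
  assumes "cv.subspace V" "linear_between V W f" "bij_betw f V W"
  shows "cv.dim V = cv.dim W"
proof -
  interpret p: vector_space_pair "scaleC :: complex \<Rightarrow> 'a \<Rightarrow> 'a" "scaleC :: complex \<Rightarrow> 'a \<Rightarrow> 'a" ..
  obtain g where g: "Vector_Spaces.linear scaleC scaleC g" "\<forall>x\<in>V. g x = f x"
    by (rule linear_between_extension[OF assms(1,2)])
  have gV: "bij_betw g V W"
    using assms(3) g(2) by (subst bij_betw_cong[where g = f]) auto
  obtain B where B: "B \<subseteq> V" "cv.independent B" "V \<subseteq> cv.span B" "card B = cv.dim V"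
    by (rule cv.basis_exists)
  have V: "cv.span B = V"
    using B assms(1) by (simp add: cv.span_subspace)
  have inj: "inj_on g (cv.span B)" and img: "g ` cv.span B = W"
    using gV by (auto simp: V bij_betw_def)
  have "cv.span (g ` B) = cv.span W"
    using img p.linear_span_image[OF g(1), of B] by (metis cv.span_span)
  then have "cv.dim W = card (g ` B)"
    using p.linear_independent_injective_image[OF g(1) B(2) inj] by (rule cv.dim_eq_card)
  moreover have "card (g ` B) = card B"
    using inj cv.span_superset by (intro card_image) (rule inj_on_subset)
  ultimately show ?thesis using B(4) by simp
qed

lemma independent_familyI:
  fixes v :: "'i \<Rightarrow> 'x::complex_vector"
  assumes fin: "finite J"
    and coeff: "\<And>c p. (\<Sum>p\<in>J. scaleC (c p) (v p)) = 0 \<Longrightarrow> p \<in> J \<Longrightarrow> c p = 0"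
  shows "inj_on v J" "cv.independent (v ` J)"
proof -
  \<comment> \<open>A coincidence of two members would give the relation with coefficients \<open>1\<close> and \<open>-1\<close>.\<close>
  show inj: "inj_on v J"
  proof (rule inj_onI, rule ccontr)
    fix p q assume pq: "p \<in> J" "q \<in> J" "v p = v q" "p \<noteq> q"
    let ?c = "\<lambda>r. (if r = p then 1 else 0) - (if r = q then 1 else 0 :: complex)"
    have "(\<Sum>r\<in>J. scaleC (?c r) (v r)) =
        (\<Sum>r\<in>J. if r = p then v r else 0) - (\<Sum>r\<in>J. if r = q then v r else 0)"
      by (subst sum_subtractf[symmetric], rule sum.cong)
         (auto simp: cv.scale_left_diff_distrib scaleC_one)
    also have "\<dots> = 0" using pq fin by simp
    finally have "?c p = 0" using pq(1) by (rule coeff)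
    then show False using pq by simp
  qed
  show "cv.independent (v ` J)"
  proof (rule cv.independent_if_scalars_zero)
    fix f x assume sum: "(\<Sum>x\<in>v ` J. scaleC (f x) x) = 0" and "x \<in> v ` J"
    then obtain p where p: "p \<in> J" "x = v p" by auto
    have "(\<Sum>p\<in>J. scaleC (f (v p)) (v p)) = 0"
      using sum by (simp add: sum.reindex[OF inj])
    then show "f x = 0" using coeff[where c = "\<lambda>p. f (v p)"] p by blast
  qed (use fin in simp)
qed


section \<open>Group actions\<close>

lemma group_actionI:
  assumes G: "group G"
    and ext: "\<And>g. g \<in> carrier G \<Longrightarrow> \<phi> g \<in> extensional X"
    and closed: "\<And>g x. g \<in> carrier G \<Longrightarrow> x \<in> X \<Longrightarrow> \<phi> g x \<in> X"
    and one: "\<And>x. x \<in> X \<Longrightarrow> \<phi> \<one>\<^bsub>G\<^esub> x = x"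
    and mult: "\<And>g h x. g \<in> carrier G \<Longrightarrow> h \<in> carrier G \<Longrightarrow> x \<in> X \<Longrightarrow>
                 \<phi> (g \<otimes>\<^bsub>G\<^esub> h) x = \<phi> g (\<phi> h x)"
  shows "group_action G X \<phi>"
proof -
  have Bij: "\<phi> g \<in> Bij X" if g: "g \<in> carrier G" for g
  proof -
    have inv: "inv\<^bsub>G\<^esub> g \<in> carrier G" using group.inv_closed[OF G g] .
    have "bij_betw (\<phi> g) X X"
    proof (rule bij_betw_byWitness[where f' = "\<phi> (inv\<^bsub>G\<^esub> g)"])
      show "\<forall>x\<in>X. \<phi> (inv\<^bsub>G\<^esub> g) (\<phi> g x) = x"
        using mult[OF inv g] one group.l_inv[OF G g] by simp
      show "\<forall>x\<in>X. \<phi> g (\<phi> (inv\<^bsub>G\<^esub> g) x) = x"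
        using mult[OF g inv] one group.r_inv[OF G g] by simp
    qed (use closed g inv in auto)
    then show ?thesis using ext[OF g] by (simp add: Bij_def)
  qed
  have "\<phi> (g \<otimes>\<^bsub>G\<^esub> h) = compose X (\<phi> g) (\<phi> h)" if "g \<in> carrier G" "h \<in> carrier G" for g h
    by (rule extensionalityI[where A = X])
       (use that ext mult group.is_monoid[OF G] in
         \<open>auto simp: compose_def intro: monoid.m_closed\<close>)
  then have "\<phi> \<in> hom G (BijGroup X)"
    using Bij by (auto simp: hom_def BijGroup_def)
  then have "group_hom G (BijGroup X) \<phi>"
    using G group_BijGroup by (auto intro!: group_hom.intro group_hom_axioms.intro)
  then show ?thesis by (rule group_action.intro)
qed

lemma group_action_Sigma:
  assumes G: "group G" and act: "\<And>c. c \<in> I \<Longrightarrow> group_action G (X c) (\<phi> c)"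
  shows "group_action G (Sigma I X) (\<lambda>g. \<lambda>(c, x)\<in>Sigma I X. (c, \<phi> c g x))"
proof (rule group_actionI[OF G])
  fix p g assume g: "g \<in> carrier G" and p: "p \<in> Sigma I X"
  show "(\<lambda>(c, x)\<in>Sigma I X. (c, \<phi> c g x)) p \<in> Sigma I X"
    using p g group_action.element_image[OF act] by force
next
  fix p assume p: "p \<in> Sigma I X"
  show "(\<lambda>(c, x)\<in>Sigma I X. (c, \<phi> c \<one>\<^bsub>G\<^esub> x)) p = p"
    using p group_action.id_eq_one[OF act] by (auto simp: fun_eq_iff restrict_def split: if_splits) metis
next
  fix g h p assume gh: "g \<in> carrier G" "h \<in> carrier G" and p: "p \<in> Sigma I X"
  then obtain c x where cx: "p = (c, x)" "c \<in> I" "x \<in> X c" by auto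
  show "(\<lambda>(c, x)\<in>Sigma I X. (c, \<phi> c (g \<otimes>\<^bsub>G\<^esub> h) x)) p =
      (\<lambda>(c, x)\<in>Sigma I X. (c, \<phi> c g x)) ((\<lambda>(c, x)\<in>Sigma I X. (c, \<phi> c h x)) p)"
    using cx group_action.composition_rule[OF act[OF cx(2)] cx(3) gh]
      group_action.element_image[OF act[OF cx(2)] gh(2) cx(3) refl]
    by simp
qed simp


section \<open>Semi-invariant actions on quiver representations\<close>

text \<open>
  The operators commute with each structure map of the representation \<open>V\<close> up to a number
  depending on the group element and the arrow.  Subrepresentations consist of subspaces, which
  do not see this number, so the group acts on every quiver Grassmannian of \<open>V\<close>.
\<close>

locale semi_invariant_action =
  fixes Q :: "('v, 'a) pre_digraph" and V :: "('v, 'a, 'x::complex_vector) qrep"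
    and G :: "('g, 'm) monoid_scheme" (structure) and \<tau> :: "'g \<Rightarrow> 'v \<Rightarrow> 'x \<Rightarrow> 'x"
  assumes wf: "wf_digraph Q" and group: "group G"
    and linear: "\<And>g v. \<lbrakk>g \<in> carrier G; v \<in> verts Q\<rbrakk> \<Longrightarrow>
          linear_between (vsp V v) (vsp V v) (\<tau> g v)"
    and one: "\<And>v x. \<lbrakk>v \<in> verts Q; x \<in> vsp V v\<rbrakk> \<Longrightarrow> \<tau> \<one> v x = x"
    and mult: "\<And>g h v x. \<lbrakk>g \<in> carrier G; h \<in> carrier G; v \<in> verts Q; x \<in> vsp V v\<rbrakk> \<Longrightarrow>
          \<tau> (g \<otimes> h) v x = \<tau> g v (\<tau> h v x)"
    and arc: "\<And>g a. \<lbrakk>g \<in> carrier G; a \<in> arcs Q\<rbrakk> \<Longrightarrow>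
          \<exists>c. \<forall>x\<in>vsp V (tail Q a).
            vmap V a (\<tau> g (tail Q a) x) = scaleC c (\<tau> g (head Q a) (vmap V a x))"
begin

lemma inj_on_operator:
  assumes g: "g \<in> carrier G" and v: "v \<in> verts Q"
  shows "inj_on (\<tau> g v) (vsp V v)"
proof (rule inj_on_inverseI)
  fix x assume "x \<in> vsp V v"
  then show "\<tau> (inv g) v (\<tau> g v x) = x"
    using mult[of "inv g" g v x] g v one group.inv_closed[OF group g] group.l_inv[OF group g]
    by simp
qed

lemma translate_in_Gr:
  assumes g: "g \<in> carrier G" and U: "U \<in> Gr Q V f"
  shows "(\<lambda>v\<in>verts Q. \<tau> g v ` U v) \<in> Gr Q V f"
proof -
  have sub: "cv.subspace (U v)" "U v \<subseteq> vsp V v" "cv.dim (U v) = f v" if "v \<in> verts Q" for v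
    using U that by (auto simp: Gr_def is_subrep_def)
  have maps: "vmap V a ` U (tail Q a) \<subseteq> U (head Q a)" if "a \<in> arcs Q" for a
    using U that by (auto simp: Gr_def is_subrep_def)
  have lin: "linear_between (U v) (\<tau> g v ` U v) (\<tau> g v)" if "v \<in> verts Q" for v
    using linear_between_subset[OF linear[OF g that] sub(2)[OF that]] by blast
  have space: "cv.subspace (\<tau> g v ` U v)" if "v \<in> verts Q" for v
    using subspace_linear_between_image[OF sub(1) lin] that by blast
  have "\<tau> g v ` U v \<subseteq> vsp V v" if "v \<in> verts Q" for v
    using sub(2)[OF that] linear_between_mem[OF linear[OF g that]] by blast
  moreover have "cv.dim (\<tau> g v ` U v) = f v" if "v \<in> verts Q" for v
  proof -
    have "bij_betw (\<tau> g v) (U v) (\<tau> g v ` U v)"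
      using inj_on_subset[OF inj_on_operator[OF g that] sub(2)[OF that]]
      by (rule inj_on_imp_bij_betw)
    then show ?thesis using dim_linear_bij[OF sub(1) lin] sub(3) that by simp
  qed
  moreover have "vmap V a ` \<tau> g (tail Q a) ` U (tail Q a) \<subseteq> \<tau> g (head Q a) ` U (head Q a)"
    if a: "a \<in> arcs Q" for a
  proof -
    have ends: "tail Q a \<in> verts Q" "head Q a \<in> verts Q"
      using wf a by (simp_all add: wf_digraph_def)
    obtain c where c: "\<And>x. x \<in> vsp V (tail Q a) \<Longrightarrow>
        vmap V a (\<tau> g (tail Q a) x) = scaleC c (\<tau> g (head Q a) (vmap V a x))"
      using arc[OF g a] by blast
    show ?thesis
    proof clarify
      fix x assume x: "x \<in> U (tail Q a)"
      then have "vmap V a x \<in> U (head Q a)" using maps[OF a] by blast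
      then have "scaleC c (\<tau> g (head Q a) (vmap V a x)) \<in> \<tau> g (head Q a) ` U (head Q a)"
        using cv.subspace_scale[OF space[OF ends(2)]] by blast
      then show "vmap V a (\<tau> g (tail Q a) x) \<in> \<tau> g (head Q a) ` U (head Q a)"
        using c x sub(2)[OF ends(1)] by auto
    qed
  qed
  ultimately show ?thesis
    using space wf by (auto simp: Gr_def is_subrep_def wf_digraph_def)
qed

proposition group_action_Gr:
  "group_action G (Gr Q V f) (\<lambda>g. \<lambda>U\<in>Gr Q V f. \<lambda>v\<in>verts Q. \<tau> g v ` U v)"
proof (rule group_actionI[OF group])
  fix g U assume "g \<in> carrier G" "U \<in> Gr Q V f"
  then show "(\<lambda>U\<in>Gr Q V f. \<lambda>v\<in>verts Q. \<tau> g v ` U v) U \<in> Gr Q V f"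
    using translate_in_Gr by simp
next
  fix U assume U: "U \<in> Gr Q V f"
  have "\<tau> \<one> v ` U v = U v" if "v \<in> verts Q" for v
  proof -
    have "U v \<subseteq> vsp V v" using U that by (auto simp: Gr_def is_subrep_def)
    then have "\<tau> \<one> v ` U v = (\<lambda>x. x) ` U v"
      using one[OF that] by (intro image_cong) auto
    then show ?thesis by simp
  qed
  then have "(\<lambda>v\<in>verts Q. \<tau> \<one> v ` U v) = U"
    using U by (intro extensionalityI[where A = "verts Q"]) (auto simp: Gr_def)
  then show "(\<lambda>U\<in>Gr Q V f. \<lambda>v\<in>verts Q. \<tau> \<one> v ` U v) U = U"
    using U by simp
next
  fix g h U assume gh: "g \<in> carrier G" "h \<in> carrier G" and U: "U \<in> Gr Q V f"
  have "\<tau> (g \<otimes> h) v ` U v = \<tau> g v ` \<tau> h v ` U v" if v: "v \<in> verts Q" for v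
  proof -
    have "U v \<subseteq> vsp V v" using U v by (auto simp: Gr_def is_subrep_def)
    then show ?thesis
      unfolding image_image using mult[OF gh v] by (intro image_cong) auto
  qed
  then have "(\<lambda>v\<in>verts Q. \<tau> (g \<otimes> h) v ` U v) =
      (\<lambda>v\<in>verts Q. \<tau> g v ` (\<lambda>v\<in>verts Q. \<tau> h v ` U v) v)"
    by (intro restrict_ext) simp
  then show "(\<lambda>U\<in>Gr Q V f. \<lambda>v\<in>verts Q. \<tau> (g \<otimes> h) v ` U v) U =
      (\<lambda>U\<in>Gr Q V f. \<lambda>v\<in>verts Q. \<tau> g v ` U v) ((\<lambda>U\<in>Gr Q V f. \<lambda>v\<in>verts Q. \<tau> h v ` U v) U)"
    using U translate_in_Gr[OF gh(2) U] by simp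
qed simp

end


section \<open>The torus and its operators\<close>

lemma group_torus: "group (torus d)"
  unfolding torus_def
proof (rule product_group)
  show "group \<lparr>carrier = - {0 :: complex}, monoid.mult = (*), one = 1\<rparr>"
    by (rule groupI) (auto intro!: bexI[of _ "inverse _"])
qed

lemma torus_nonzero: "\<gamma> \<in> carrier (torus d) \<Longrightarrow> j \<le> d \<Longrightarrow> \<gamma> j \<noteq> 0"
  by (auto simp: torus_def PiE_iff)

lemma torus_mult: "j \<le> d \<Longrightarrow> (\<gamma> \<otimes>\<^bsub>torus d\<^esub> \<delta>) j = \<gamma> j * \<delta> j"
  by (simp add: torus_def)

lemma torus_one: "j \<le> d \<Longrightarrow> \<one>\<^bsub>torus d\<^esub> j = 1"
  by (simp add: torus_def)

lemma wf_cycle_quiver: "n \<ge> 1 \<Longrightarrow> wf_digraph (cycle_quiver n)"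
  by unfold_locales (auto simp: cycle_quiver_def)

lemma wf_cyl_quiver: "wf_digraph (cyl_quiver n N)"
  by unfold_locales (auto simp: cyl_quiver_def)

locale adapted_rep =
  fixes n d :: nat and M :: "(nat, nat, 'x::complex_vector) qrep"
    and S :: "nat \<Rightarrow> nat \<Rightarrow> 'x set" and l :: "nat \<Rightarrow> nat"
    and vt :: "nat \<Rightarrow> nat \<Rightarrow> nat" and b :: "nat \<Rightarrow> nat \<Rightarrow> 'x"
  assumes n_pos: "n \<ge> 1" and rep: "is_rep (cycle_quiver n) M"
    and direct_sum: "is_direct_sum (cycle_quiver n) M {1..d} S"
    and adapted: "adapted_basis n M d S l vt b"
begin

definition idx :: "nat \<Rightarrow> (nat \<times> nat) set" where
  "idx i = (SIGMA j : {1..d}. basis_at l vt j i)"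

definition bvec :: "nat \<times> nat \<Rightarrow> 'x" where
  "bvec = (\<lambda>(j, s). b j s)"

definition weight :: "(nat \<Rightarrow> complex) \<Rightarrow> nat \<times> nat \<Rightarrow> complex" where
  "weight \<gamma> = (\<lambda>(j, s). \<gamma> 0 ^ (s - 1) * \<gamma> j)"

abbreviation \<tau> :: "(nat \<Rightarrow> complex) \<Rightarrow> nat \<Rightarrow> 'x \<Rightarrow> 'x" where
  "\<tau> \<equiv> torus_op d l vt b"

lemma finite_idx: "finite (idx i)"
  by (simp add: idx_def basis_at_def)

lemma torus_op_eq:
  "\<tau> \<gamma> i x = (\<Sum>p\<in>idx i. scaleC (weight \<gamma> p * cv.representation (bvec ` idx i) x (bvec p)) (bvec p))"
  by (simp add: torus_op_def Let_def idx_def bvec_def weight_def case_prod_beta)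

lemma subspace_vsp: "i < n \<Longrightarrow> cv.subspace (vsp M i)"
  using rep by (simp add: is_rep_def cycle_quiver_def fd_subspace_imp_subspace)

lemma vmap_linear: "i < n \<Longrightarrow> linear_between (vsp M i) (vsp M ((i + 1) mod n)) (vmap M i)"
  using rep by (auto simp: is_rep_def cycle_quiver_def)

text \<open>
  The sum of the spaces \<open>S j i\<close> over \<open>j\<close> is direct, so a linear relation between basis
  vectors at \<open>i\<close> splits into relations inside the summands.
\<close>

lemma bvec_coeff_zero:
  assumes i: "i < n" and sum: "(\<Sum>p\<in>idx i. scaleC (c p) (bvec p)) = 0" and p: "p \<in> idx i"
  shows "c p = 0"
proof -
  obtain j s where js: "p = (j, s)" "j \<in> {1..d}" "s \<in> basis_at l vt j i"
    using p by (auto simp: idx_def)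
  have basis: "inj_on (b k) (basis_at l vt k i)" "cv.independent (b k ` basis_at l vt k i)"
      "cv.span (b k ` basis_at l vt k i) = S k i" if "k \<in> {1..d}" for k
    using adapted i that by (auto simp: adapted_basis_def)
  have fin: "finite (basis_at l vt k i)" for k by (simp add: basis_at_def)
  let ?x = "\<lambda>k. \<Sum>t\<in>basis_at l vt k i. scaleC (c (k, t)) (b k t)"
  have mem: "?x k \<in> S k i" if "k \<in> {1..d}" for k
    unfolding basis(3)[OF that, symmetric]
    by (intro cv.span_sum cv.span_scale cv.span_base) auto
  have "(\<Sum>k\<in>{1..d}. ?x k) = 0"
    using sum by (subst sum.Sigma) (simp_all add: fin idx_def bvec_def case_prod_beta)
  moreover have "\<forall>k\<in>{1..d}. x k = 0" if "\<forall>k\<in>{1..d}. x k \<in> S k i" "(\<Sum>k\<in>{1..d}. x k) = 0" for x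
    using direct_sum i that unfolding is_direct_sum_def cycle_quiver_def pre_digraph.select_convs
    by blast
  ultimately have "\<forall>k\<in>{1..d}. ?x k = 0" using mem by (metis (no_types, lifting))
  then have "?x j = 0" using js(2) by blast
  moreover have "?x j = (\<Sum>y\<in>b j ` basis_at l vt j i.
      scaleC (c (j, the_inv_into (basis_at l vt j i) (b j) y)) y)"
    by (subst sum.reindex[OF basis(1)[OF js(2)]])
       (auto intro!: sum.cong simp: the_inv_into_f_f[OF basis(1)[OF js(2)]])
  ultimately have "c (j, the_inv_into (basis_at l vt j i) (b j) (b j s)) = 0"
    using cv.independentD[OF basis(2)[OF js(2)] finite_imageI[OF fin] order_refl] js(3) by force
  then show ?thesis using js basis(1) by (simp add: the_inv_into_f_f)
qed

lemma inj_bvec: "i < n \<Longrightarrow> inj_on bvec (idx i)"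
  using finite_idx bvec_coeff_zero by (rule independent_familyI(1))

lemma independent_bvec: "i < n \<Longrightarrow> cv.independent (bvec ` idx i)"
  using finite_idx bvec_coeff_zero by (rule independent_familyI(2))

lemma span_bvec:
  assumes i: "i < n"
  shows "cv.span (bvec ` idx i) = vsp M i"
proof
  have basis: "cv.span (b k ` basis_at l vt k i) = S k i" if "k \<in> {1..d}" for k
    using adapted i that by (auto simp: adapted_basis_def)
  have "bvec p \<in> vsp M i" if p: "p \<in> idx i" for p
  proof -
    obtain j s where js: "p = (j, s)" "j \<in> {1..d}" "s \<in> basis_at l vt j i"
      using p by (auto simp: idx_def)
    then have "bvec p \<in> S j i" using basis by (auto simp: bvec_def cv.span_base simp flip: basis)
    moreover have "is_subrep (cycle_quiver n) M (S j)"
      using direct_sum js(2) unfolding is_direct_sum_def by blast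
    then have "S j i \<subseteq> vsp M i"
      using i by (simp add: is_subrep_def cycle_quiver_def)
    ultimately show ?thesis by blast
  qed
  then show "cv.span (bvec ` idx i) \<subseteq> vsp M i"
    using subspace_vsp[OF i] by (intro cv.span_minimal) auto
next
  show "vsp M i \<subseteq> cv.span (bvec ` idx i)"
  proof
    fix y assume "y \<in> vsp M i"
    then obtain x where x: "y = (\<Sum>j\<in>{1..d}. x j)" "\<And>j. j \<in> {1..d} \<Longrightarrow> x j \<in> S j i"
      using direct_sum i by (auto simp: is_direct_sum_def cycle_quiver_def)
    have "x j \<in> cv.span (bvec ` idx i)" if j: "j \<in> {1..d}" for j
    proof -
      have "b j ` basis_at l vt j i \<subseteq> bvec ` idx i"
        using j by (auto simp: idx_def bvec_def)
      moreover have "cv.span (b j ` basis_at l vt j i) = S j i"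
        using adapted i j by (auto simp: adapted_basis_def)
      ultimately show ?thesis using x(2)[OF j] cv.span_mono by blast
    qed
    then show "y \<in> cv.span (bvec ` idx i)" unfolding x(1) by (rule cv.span_sum)
  qed
qed

lemma torus_op_bvec:
  assumes i: "i < n" and p: "p \<in> idx i"
  shows "\<tau> \<gamma> i (bvec p) = scaleC (weight \<gamma> p) (bvec p)"
proof -
  have "cv.representation (bvec ` idx i) (bvec p) (bvec q) = (if q = p then 1 else 0)"
    if "q \<in> idx i" for q
    using cv.representation_basis[OF independent_bvec[OF i], of "bvec p"] p that
      inj_onD[OF inj_bvec[OF i]] by auto
  then have "\<tau> \<gamma> i (bvec p) = (\<Sum>q\<in>idx i. if q = p then scaleC (weight \<gamma> p) (bvec p) else 0)"
    unfolding torus_op_eq by (intro sum.cong) auto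
  then show ?thesis using p finite_idx by simp
qed

lemma torus_op_linear:
  assumes i: "i < n"
  shows "linear_between (vsp M i) (vsp M i) (\<tau> \<gamma> i)"
proof (rule linear_betweenI)
  fix x y c
  show "\<tau> \<gamma> i x \<in> vsp M i"
    unfolding torus_op_eq span_bvec[OF i, symmetric]
    by (intro cv.span_sum cv.span_scale cv.span_base) simp
  assume x: "x \<in> vsp M i"
  note x' = x[folded span_bvec[OF i]]
  show "\<tau> \<gamma> i (scaleC c x) = scaleC c (\<tau> \<gamma> i x)"
    unfolding torus_op_eq cv.representation_scale[OF independent_bvec[OF i] x']
    by (simp add: cv.scale_sum_right scaleC_scaleC mult.left_commute)
  assume y: "y \<in> vsp M i"
  note y' = y[folded span_bvec[OF i]]
  show "\<tau> \<gamma> i (x + y) = \<tau> \<gamma> i x + \<tau> \<gamma> i y"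
    unfolding torus_op_eq cv.representation_add[OF independent_bvec[OF i] y' x']
    by (simp add: distrib_left scaleC_add_left sum.distrib)
qed

lemma linear_eq_on_vsp:
  assumes i: "i < n" and f: "linear_between (vsp M i) W f" and g: "linear_between (vsp M i) W g"
    and eq: "\<And>p. p \<in> idx i \<Longrightarrow> f (bvec p) = g (bvec p)" and x: "x \<in> vsp M i"
  shows "f x = g x"
  using linear_between_eq_on_span[where B = "bvec ` idx i"] f g eq x
  unfolding span_bvec[OF i] by blast

lemma bvec_in_vsp: "i < n \<Longrightarrow> p \<in> idx i \<Longrightarrow> bvec p \<in> vsp M i"
  using span_bvec cv.span_base by blast

lemma torus_op_one:
  assumes i: "i < n" and x: "x \<in> vsp M i"
  shows "\<tau> \<one>\<^bsub>torus d\<^esub> i x = x"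
proof (rule linear_eq_on_vsp[OF i torus_op_linear[OF i] linear_between_id _ x])
  fix p assume p: "p \<in> idx i"
  then have "weight \<one>\<^bsub>torus d\<^esub> p = 1"
    by (auto simp: weight_def idx_def torus_one)
  then show "\<tau> \<one>\<^bsub>torus d\<^esub> i (bvec p) = bvec p"
    by (simp add: torus_op_bvec[OF i p] scaleC_one)
qed

lemma torus_op_mult:
  assumes i: "i < n" and x: "x \<in> vsp M i"
  shows "\<tau> (\<gamma> \<otimes>\<^bsub>torus d\<^esub> \<delta>) i x = \<tau> \<gamma> i (\<tau> \<delta> i x)"
proof (rule linear_eq_on_vsp[OF i torus_op_linear[OF i]
      linear_between_comp[OF torus_op_linear[OF i] torus_op_linear[OF i]] _ x])
  fix p assume p: "p \<in> idx i"
  then have "weight (\<gamma> \<otimes>\<^bsub>torus d\<^esub> \<delta>) p = weight \<gamma> p * weight \<delta> p"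
    by (auto simp: weight_def idx_def torus_mult power_mult_distrib)
  then show "\<tau> (\<gamma> \<otimes>\<^bsub>torus d\<^esub> \<delta>) i (bvec p) = \<tau> \<gamma> i (\<tau> \<delta> i (bvec p))"
    by (simp add: torus_op_bvec[OF i p] linear_between_scale[OF torus_op_linear[OF i]]
        bvec_in_vsp[OF i p] scaleC_scaleC mult.commute)
qed

text \<open>
  A structure map sends \<open>b j s\<close> to \<open>b j (s + 1)\<close>, whose weight has one more factor \<open>\<gamma> 0\<close>, or
  to \<open>0\<close>.  Hence \<open>\<gamma>\<close> commutes with the structure maps only up to the scalar \<open>\<gamma> 0\<close>.
\<close>

lemma torus_op_vmap:
  assumes i: "i < n" and x: "x \<in> vsp M i"
  shows "\<tau> \<gamma> ((i + 1) mod n) (vmap M i x) = scaleC (\<gamma> 0) (vmap M i (\<tau> \<gamma> i x))"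
proof (rule linear_eq_on_vsp[OF i _ _ _ x])
  let ?i = "(i + 1) mod n"
  have i': "?i < n" using n_pos by simp
  show "linear_between (vsp M i) (vsp M ?i) (\<lambda>x. \<tau> \<gamma> ?i (vmap M i x))"
    by (rule linear_between_comp[OF vmap_linear[OF i] torus_op_linear[OF i']])
  show "linear_between (vsp M i) (vsp M ?i) (\<lambda>x. scaleC (\<gamma> 0) (vmap M i (\<tau> \<gamma> i x)))"
    by (rule linear_between_scaled[OF linear_between_comp[OF torus_op_linear[OF i] vmap_linear[OF i]]
          subspace_vsp[OF i']])
  fix p assume p: "p \<in> idx i"
  then obtain j s where js: "p = (j, s)" "j \<in> {1..d}" "1 \<le> s" "s \<le> l j" "vt j s = i"
    by (auto simp: idx_def basis_at_def)
  have v: "vmap M i (\<tau> \<gamma> i (bvec p)) = scaleC (weight \<gamma> p) (vmap M i (bvec p))"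
    by (simp add: torus_op_bvec[OF i p] linear_between_scale[OF vmap_linear[OF i]] bvec_in_vsp[OF i p])
  show "\<tau> \<gamma> ?i (vmap M i (bvec p)) = scaleC (\<gamma> 0) (vmap M i (\<tau> \<gamma> i (bvec p)))"
  proof (cases "s < l j")
    case True
    then have next_vec: "vt j (s + 1) = ?i" "vmap M i (bvec p) = bvec (j, s + 1)"
      using adapted js by (auto simp: adapted_basis_def bvec_def)
    then have "(j, s + 1) \<in> idx ?i" using True js by (auto simp: idx_def basis_at_def)
    moreover have "weight \<gamma> (j, s + 1) = \<gamma> 0 * weight \<gamma> p"
      using js(1,3) by (cases s) (simp_all add: weight_def)
    ultimately show ?thesis
      unfolding v next_vec(2) using torus_op_bvec[OF i'] by (simp add: scaleC_scaleC)
  next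
    case False
    then have "s = l j" using js(4) by simp
    then have "vmap M i (bvec p) = 0"
      using adapted js unfolding adapted_basis_def by (auto simp: bvec_def)
    moreover have "\<tau> \<gamma> ?i 0 = 0"
      using linear_between_scale[OF torus_op_linear[OF i'] cv.subspace_0[OF subspace_vsp[OF i']], of \<gamma> 0]
      by simp
    ultimately show ?thesis unfolding v by simp
  qed
qed

lemma path_map_linear:
  assumes i: "i < n"
  shows "linear_between (vsp M i) (vsp M ((i + m) mod n)) (path_map n M i m)"
proof (induction m)
  case 0
  then show ?case using i by (simp add: linear_between_def)
next
  case (Suc m)
  have "linear_between (vsp M ((i + m) mod n)) (vsp M ((i + Suc m) mod n)) (vmap M ((i + m) mod n))"
    using vmap_linear[of "(i + m) mod n"] n_pos by (simp add: mod_Suc_eq)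
  then show ?case using linear_between_comp[OF Suc] by (simp add: comp_def)
qed

lemma torus_op_path_map:
  assumes i: "i < n" and x: "x \<in> vsp M i"
  shows "\<tau> \<gamma> ((i + m) mod n) (path_map n M i m x) = scaleC (\<gamma> 0 ^ m) (path_map n M i m (\<tau> \<gamma> i x))"
proof (induction m)
  case 0
  then show ?case using i by (simp add: scaleC_one)
next
  case (Suc m)
  let ?k = "(i + m) mod n"
  have k: "?k < n" "(?k + 1) mod n = (i + Suc m) mod n" using n_pos by (simp_all add: mod_Suc_eq)
  have "\<tau> \<gamma> ((i + Suc m) mod n) (path_map n M i (Suc m) x) =
      scaleC (\<gamma> 0) (vmap M ?k (\<tau> \<gamma> ?k (path_map n M i m x)))"
    using torus_op_vmap[OF k(1) linear_between_mem[OF path_map_linear[OF i] x]]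
    unfolding k(2) by simp
  also have "\<dots> = scaleC (\<gamma> 0 ^ Suc m) (path_map n M i (Suc m) (\<tau> \<gamma> i x))"
    unfolding Suc using linear_between_scale[OF vmap_linear[OF k(1)]]
      linear_between_mem[OF path_map_linear[OF i]] linear_between_mem[OF torus_op_linear[OF i] x]
    by (simp add: scaleC_scaleC)
  finally show ?case .
qed

lemma Lam_subset:
  assumes "i < n" "k \<ge> 1"
  shows "vsp (Lam n M) (i, k) \<subseteq> vsp M ((i + k - 1) mod n)"
  using linear_between_mem[OF path_map_linear[OF assms(1)], of _ "k - 1"] assms(2)
  by (auto simp: Lam_def)

text \<open>
  Moving \<open>\<gamma>\<close> through the \<open>k - 1\<close> maps whose composition has the image \<open>vsp (Lam n M) (i, k)\<close>
  only costs a scalar, and this image is closed under scalar multiplication.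
\<close>

lemma torus_op_Lam:
  assumes i: "i < n" and k: "k \<ge> 1" and y: "y \<in> vsp (Lam n M) (i, k)"
  shows "\<tau> \<gamma> ((i + k - 1) mod n) y \<in> vsp (Lam n M) (i, k)"
proof -
  obtain x where x: "x \<in> vsp M i" "y = path_map n M i (k - 1) x"
    using y by (auto simp: Lam_def)
  note \<tau>x = linear_between_mem[OF torus_op_linear[OF i] x(1)]
  have "\<tau> \<gamma> ((i + k - 1) mod n) y = scaleC (\<gamma> 0 ^ (k - 1)) (path_map n M i (k - 1) (\<tau> \<gamma> i x))"
    using torus_op_path_map[OF i x(1), of \<gamma> "k - 1"] k x(2) by simp
  also have "\<dots> = path_map n M i (k - 1) (scaleC (\<gamma> 0 ^ (k - 1)) (\<tau> \<gamma> i x))"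
    using linear_between_scale[OF path_map_linear[OF i] \<tau>x] by simp
  finally show ?thesis
    using cv.subspace_scale[OF subspace_vsp[OF i] \<tau>x] by (auto simp: Lam_def)
qed

lemma vmap_torus_op:
  assumes i: "i < n" and x: "x \<in> vsp M i" and \<gamma>: "\<gamma> \<in> carrier (torus d)"
  shows "vmap M i (\<tau> \<gamma> i x) = scaleC (inverse (\<gamma> 0)) (\<tau> \<gamma> ((i + 1) mod n) (vmap M i x))"
  using torus_op_vmap[OF i x] torus_nonzero[OF \<gamma>, of 0] by (simp add: scaleC_scaleC scaleC_one)

sublocale cycle: semi_invariant_action "cycle_quiver n" M "torus d" \<tau>
proof (rule semi_invariant_action.intro)
  fix \<gamma> i assume "\<gamma> \<in> carrier (torus d)" "i \<in> arcs (cycle_quiver n)"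
  then show "\<exists>c. \<forall>x\<in>vsp M (tail (cycle_quiver n) i).
      vmap M i (\<tau> \<gamma> (tail (cycle_quiver n) i) x) =
        scaleC c (\<tau> \<gamma> (head (cycle_quiver n) i) (vmap M i x))"
    using vmap_torus_op by (auto simp: cycle_quiver_def)
qed (use wf_cycle_quiver[OF n_pos] group_torus torus_op_linear torus_op_one torus_op_mult in
       \<open>simp_all add: cycle_quiver_def\<close>)

sublocale cyl: semi_invariant_action "cyl_quiver n N" "Lam n M" "torus d"
    "\<lambda>\<gamma> (i, k). \<tau> \<gamma> ((i + k - 1) mod n)" for N
proof (rule semi_invariant_action.intro)
  fix \<gamma> \<delta> v x
  assume v: "v \<in> verts (cyl_quiver n N)"
  then obtain i k where ik: "v = (i, k)" "i < n" "k \<ge> 1"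
    by (auto simp: cyl_quiver_def)
  have m: "(i + k - 1) mod n < n" using n_pos by simp
  note sub = Lam_subset[OF ik(2,3)]
  show "linear_between (vsp (Lam n M) v) (vsp (Lam n M) v)
      (case v of (i, k) \<Rightarrow> \<tau> \<gamma> ((i + k - 1) mod n))"
    unfolding ik(1) prod.case
    using torus_op_Lam[OF ik(2,3)] by (intro linear_between_subset[OF torus_op_linear[OF m] sub]) blast
  assume "x \<in> vsp (Lam n M) v"
  then have x: "x \<in> vsp M ((i + k - 1) mod n)" using sub ik(1) by blast
  show "(case v of (i, k) \<Rightarrow> \<tau> \<one>\<^bsub>torus d\<^esub> ((i + k - 1) mod n)) x = x"
    unfolding ik(1) prod.case by (rule torus_op_one[OF m x])
  show "(case v of (i, k) \<Rightarrow> \<tau> (\<gamma> \<otimes>\<^bsub>torus d\<^esub> \<delta>) ((i + k - 1) mod n)) x =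
      (case v of (i, k) \<Rightarrow> \<tau> \<gamma> ((i + k - 1) mod n)) ((case v of (i, k) \<Rightarrow> \<tau> \<delta> ((i + k - 1) mod n)) x)"
    unfolding ik(1) prod.case by (rule torus_op_mult[OF m x])
next
  fix \<gamma> a assume \<gamma>: "\<gamma> \<in> carrier (torus d)" and a: "a \<in> arcs (cyl_quiver n N)"
  let ?Q = "cyl_quiver n N"
  let ?\<tau> = "\<lambda>(i, k). \<tau> \<gamma> ((i + k - 1) mod n)"
  show "\<exists>c. \<forall>x\<in>vsp (Lam n M) (tail ?Q a). vmap (Lam n M) a (?\<tau> (tail ?Q a) x) =
      scaleC c (?\<tau> (head ?Q a) (vmap (Lam n M) a x))"
  proof (cases a)
    case (Alpha i k)
    then have ik: "i < n" "k \<ge> 1" using a by (auto simp: cyl_quiver_def)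
    let ?m = "(i + k - 1) mod n"
    have m: "?m < n" "(?m + 1) mod n = (i + (k + 1) - 1) mod n"
      using n_pos ik(2) by (simp_all add: mod_Suc_eq)
    have "vmap M ?m (\<tau> \<gamma> ?m x) =
        scaleC (inverse (\<gamma> 0)) (\<tau> \<gamma> ((i + (k + 1) - 1) mod n) (vmap M ?m x))"
      if "x \<in> vsp (Lam n M) (i, k)" for x
      using vmap_torus_op[OF m(1) _ \<gamma>] Lam_subset[OF ik] that unfolding m(2) by blast
    then show ?thesis
      unfolding Alpha by (intro exI[of _ "inverse (\<gamma> 0)"]) (simp add: cyl_quiver_def Lam_def)
  next
    case (Beta i k)
    then have k: "k \<ge> 2" using a by (auto simp: cyl_quiver_def)
    \<comment> \<open>Both ends of the arrow carry the same operator, and the structure map is the identity.\<close>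
    have "((i + 1) mod n + (k - 1) - 1) mod n = ((i + 1) mod n + (k - 2)) mod n"
      using k by (intro arg_cong2[where f = "(mod)"]) auto
    also have "\<dots> = (i + 1 + (k - 2)) mod n"
      by (rule mod_add_left_eq)
    also have "\<dots> = (i + k - 1) mod n"
      using k by (intro arg_cong2[where f = "(mod)"]) auto
    finally show ?thesis
      unfolding Beta by (intro exI[of _ 1]) (simp add: cyl_quiver_def Lam_def scaleC_one)
  qed
qed (simp_all add: wf_cyl_quiver group_torus)

end


section \<open>The desingularization map\<close>

lemma rep_iso_refl: "rep_iso Q V V"
  unfolding rep_iso_def by (rule exI[of _ "\<lambda>_ x. x"]) (auto simp: linear_between_id bij_betw_def)

lemma rep_iso_dim:
  assumes "rep_iso Q V W" "v \<in> verts Q" "cv.subspace (vsp V v)"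
  shows "cv.dim (vsp V v) = cv.dim (vsp W v)"
  using assms dim_linear_bij unfolding rep_iso_def by blast

text \<open>
  \<open>\<Lambda>(E)\<close> has the same spaces as \<open>E\<close> in its first layer, and \<open>E\<close> is isomorphic to a point of
  the Grassmannian because its stratum is nonempty.
\<close>

lemma dim_hat_first_layer:
  assumes c: "c \<in> gsub (cycle_quiver n) M e" and i: "i < n"
  shows "dim_hat n c (i, 1) = e i"
proof -
  let ?Q = "cycle_quiver n"
  have v: "i \<in> verts ?Q" using i by (simp add: cycle_quiver_def)
  obtain E U where E: "c = iso_class ?Q E" "is_rep ?Q E"
    and U: "U \<in> Gr ?Q M e" "rep_iso ?Q (subrep M U) E"
    using c by (auto simp: gsub_def stratum_def)
  define E' where "E' = (SOME E. E \<in> c)"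
  have "E \<in> c" using E rep_iso_refl by (simp add: iso_class_def)
  then have "E' \<in> c" unfolding E'_def by (rule someI)
  then have iso: "rep_iso ?Q E E'" by (simp add: E(1) iso_class_def)
  have "cv.subspace (vsp E i)"
    using E(2) v by (simp add: is_rep_def fd_subspace_imp_subspace)
  then have "cv.dim (vsp E' i) = cv.dim (vsp E i)"
    using rep_iso_dim[OF iso v] by simp
  also have "\<dots> = cv.dim (U i)"
    using rep_iso_dim[OF U(2) v] U(1) v by (simp add: subrep_def Gr_def is_subrep_def)
  also have "\<dots> = e i" using U(1) v by (simp add: Gr_def)
  finally show ?thesis by (simp add: dim_hat_def dimvec_def Lam_def flip: E'_def)
qed

text \<open>
  A structure map of \<open>M\<close> factors through the second layer of \<open>\<Lambda>(M)\<close> by the arrows \<open>Alpha i 1\<close>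
  and \<open>Beta i 2\<close>.  There is no second layer if \<open>N = 1\<close>, but then the structure maps of \<open>M\<close>
  vanish.
\<close>

lemma pi_map_in_Gr:
  assumes N: "N \<ge> 1" and M: "nilpotent_rep n N M" and c: "c \<in> gsub (cycle_quiver n) M e"
    and U: "U \<in> Gr (cyl_quiver n N) (Lam n M) (dim_hat n c)"
  shows "pi_map n N M U \<in> Gr (cycle_quiver n) M e"
proof -
  have sub: "cv.subspace (U (i, 1))" "U (i, 1) \<subseteq> vsp M i" "cv.dim (U (i, 1)) = e i"
    if i: "i < n" for i
  proof -
    have "(i, 1) \<in> verts (cyl_quiver n N)" using i N by (simp add: cyl_quiver_def)
    then have "cv.subspace (U (i, 1))" "U (i, 1) \<subseteq> vsp (Lam n M) (i, 1)"
        "cv.dim (U (i, 1)) = dim_hat n c (i, 1)"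
      using U unfolding Gr_def is_subrep_def by blast+
    then show "cv.subspace (U (i, 1))" "U (i, 1) \<subseteq> vsp M i" "cv.dim (U (i, 1)) = e i"
      using dim_hat_first_layer[OF c i] by (simp_all add: Lam_def)
  qed
  have maps: "vmap M i ` U (i, 1) \<subseteq> U ((i + 1) mod n, 1)" if i: "i < n" for i
  proof (cases "N = 1")
    case True
    then have "vmap M i x = 0" if "x \<in> U (i, 1)" for x
      using M i sub(2)[OF i] that by (auto simp: nilpotent_rep_def)
    moreover have "0 \<in> U ((i + 1) mod n, 1)"
      using i by (intro cv.subspace_0 sub(1)) simp
    ultimately show ?thesis by auto
  next
    case False
    then have arcs: "Alpha i 1 \<in> arcs (cyl_quiver n N)" "Beta i 2 \<in> arcs (cyl_quiver n N)"
      using i N by (auto simp: cyl_quiver_def)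
    have step: "vmap (Lam n M) a ` U (tail (cyl_quiver n N) a) \<subseteq> U (head (cyl_quiver n N) a)"
      if "a \<in> arcs (cyl_quiver n N)" for a
      using U that by (simp add: Gr_def is_subrep_def)
    have "vmap M i ` U (i, 1) \<subseteq> U (i, 2)"
      using step[OF arcs(1)] i by (simp add: cyl_quiver_def Lam_def numeral_2_eq_2)
    moreover have "U (i, 2) \<subseteq> U ((i + 1) mod n, 1)"
      using step[OF arcs(2)] by (simp add: cyl_quiver_def Lam_def)
    ultimately show ?thesis by blast
  qed
  have "pi_map n N M U = (\<lambda>i\<in>{..<n}. U (i, 1))"
    by (simp add: pi_map_def res_rep_def subrep_def cycle_quiver_def)
  moreover have "(i + 1) mod n < n" if "i < n" for i using that by simp
  ultimately show ?thesis
    using sub maps by (auto simp: Gr_def is_subrep_def cycle_quiver_def)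
qed

text \<open>
  At a vertex of the first layer the torus acts on \<open>\<Lambda>(M)\<close> by the same operator as on \<open>M\<close>.
\<close>

lemma desing_map_act:
  assumes N: "N \<ge> 1" and p: "p \<in> desing_source n N M e"
    and img: "desing_map n N M p \<in> Gr (cycle_quiver n) M e"
  shows "desing_map n N M (act_source n N M e d l vt b \<gamma> p) =
         act_target n M e d l vt b \<gamma> (desing_map n N M p)"
proof -
  obtain c U where "p = (c, U)" by fastforce
  then show ?thesis
    using p img N
    by (auto simp: desing_map_def act_source_def act_target_def pi_map_def res_rep_def subrep_def
        cycle_quiver_def cyl_quiver_def intro!: restrict_ext)
qed


theorem lemma5p3:
  fixes n N d :: nat
    and M :: "(nat, nat, 'x::complex_vector) qrep"
    and e :: "nat \<Rightarrow> nat"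
    and S :: "nat \<Rightarrow> nat \<Rightarrow> 'x set"
    and l :: "nat \<Rightarrow> nat"
    and vt :: "nat \<Rightarrow> nat \<Rightarrow> nat"
    and b :: "nat \<Rightarrow> nat \<Rightarrow> 'x"
  assumes "n \<ge> 1" and "N \<ge> 1"
    and "nilpotent_rep n N M"
    and "indecomposable_decomposition (cycle_quiver n) M d S"
    and "adapted_basis n M d S l vt b"
  shows "equivariant_map (torus d)
           (desing_source n N M e) (act_source n N M e d l vt b)
           (Gr (cycle_quiver n) M e) (act_target n M e d l vt b)
           (desing_map n N M)"
proof -
  interpret adapted_rep n d M S l vt b
    using assms by unfold_locales (auto simp: nilpotent_rep_def indecomposable_decomposition_def)
  have target: "group_action (torus d) (Gr (cycle_quiver n) M e) (act_target n M e d l vt b)"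
    using cycle.group_action_Gr[of e] unfolding act_target_def .
  have "act_source n N M e d l vt b =
      (\<lambda>\<gamma>. \<lambda>(c, U)\<in>desing_source n N M e.
        (c, (\<lambda>U\<in>Gr (cyl_quiver n N) (Lam n M) (dim_hat n c). \<lambda>v\<in>verts (cyl_quiver n N).
              (case v of (i, k) \<Rightarrow> torus_op d l vt b \<gamma> ((i + k - 1) mod n)) ` U v) U))"
    unfolding act_source_def
    by (intro ext restrict_ext) (auto simp: desing_source_def fun_eq_iff)
  then have source: "group_action (torus d) (desing_source n N M e) (act_source n N M e d l vt b)"
    using group_action_Sigma[OF group_torus cyl.group_action_Gr[of N]]
    unfolding desing_source_def by simp
  have map: "desing_map n N M p \<in> Gr (cycle_quiver n) M e" if "p \<in> desing_source n N M e" for p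
    using that pi_map_in_Gr[OF assms(2,3)] by (auto simp: desing_source_def desing_map_def)
  show ?thesis
    unfolding equivariant_map_def
    using source target map by (simp add: desing_map_act[OF assms(2)] Pi_def del: split_paired_All)
qed

end
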